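(* Let $k$ be a positive integer with $k \equiv 3 \pmod 5$ and let \[ n = L_{CC}(10,k) = \frac{512k^5+1280k^4+6560k^3+7600k^2+4180k+1344}{3125}. \] Then there is an undirected Cayley graph of the cyclic group $\mathbb{Z}_n$ on five generators which has diameter $k$. Moreover, a generating set for such a graph is \[ \Big\{1,\ \tfrac{128k^4+64k^3+1112k^2-1224k-1557}{625},\ \tfrac{256k^4+448k^3+2944k^2+1592k+271}{625},\ \tfrac{256k^4+608k^3+3104k^2+3062k+726}{625},\ \tfrac{384k^4+672k^3+4216k^2+2338k-456}{625}\Big\}, \] i.e. the Cayley graph of $\mathbb{Z}_n$ with connection set $\{\pm g_1,\dots,\pm g_5\}$, where $g_1,\dots,g_5$ are these integers taken modulo $n$, has diameter $k$.
   Context: For a positive integer $n$ and integers $g_1,\dots,g_5$, the undirected Cayley (circulant) graph of the cyclic group $\mathbb{Z}_n$ with generating set $\{g_1,\dots,g_5\}$ has vertex set $\mathbb{Z}_n$, with $i$ and $j$ adjacent if and only if $j-i \equiv \pm g_t \pmod n$ for some $t$. Its diameter is the maximum over pairs of vertices of the graph distance. The notation $L_{CC}(10,k)$ is just a name for the displayed polynomial value. *)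

theory Defs
  imports
    "Graph_Theory.Graph_Theory"
    "HOL-Number_Theory.Cong"
begin

text \<open>
  The vertices of the Cayley graph of \<open>\<int>\<^sub>n\<close> are the representatives \<open>0, \<dots>, n - 1\<close>. As usual in
  \<^theory>\<open>Graph_Theory.Digraph\<close>, an undirected graph is a digraph with a symmetric arc relation.
  The elements of \<open>S\<close> only matter modulo \<open>n\<close>.
\<close>

definition circulant :: "nat \<Rightarrow> int set \<Rightarrow> int pair_pre_digraph" where
  "circulant n S =
     \<lparr> pverts = {0..<int n},
       parcs = {(i, j). i \<in> {0..<int n} \<and> j \<in> {0..<int n} \<and>
                  (\<exists>g\<in>S. [j - i = g] (mod int n) \<or> [j - i = - g] (mod int n))} \<rparr>"

text \<open>Distances are shortest-path distances for unit arc weights (infinite between different components).\<close>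

definition graph_dist :: "('a, 'b) pre_digraph \<Rightarrow> 'a \<Rightarrow> 'a \<Rightarrow> ereal" where
  "graph_dist G u v = wf_digraph.\<mu> G (\<lambda>_. 1) u v"

definition graph_diameter :: "('a, 'b) pre_digraph \<Rightarrow> ereal" where
  "graph_diameter G = (SUP (u, v) \<in> verts G \<times> verts G. graph_dist G u v)"

lemma wf_digraph_circulant: "wf_digraph (with_proj (circulant n S))"
  by unfold_locales (auto simp: circulant_def)

lemma symmetric_circulant: "symmetric (with_proj (circulant n S))"
proof -
  have *: "[j - i = g] (mod int n) \<or> [j - i = - g] (mod int n)"
    if "[i - j = g] (mod int n) \<or> [i - j = - g] (mod int n)" for i j g
    using that cong_minus_minus_iff[of "i - j" g "int n"]
      cong_minus_minus_iff[of "i - j" "- g" "int n"] by auto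
  show ?thesis
    unfolding symmetric_def sym_def circulant_def using * by simp blast
qed

lemma graph_dist_eq_INF_length:
  assumes "wf_digraph G"
  shows "graph_dist G u v = (INF p \<in> {p. pre_digraph.awalk G u p v}. ereal (real (length p)))"
proof -
  interpret wf_digraph G by fact
  show ?thesis
    by (simp add: graph_dist_def \<mu>_def awalk_cost_def sum_list_triv)
qed

text \<open>
  For \<open>k \<equiv> 3 (mod 5)\<close> all divisions in the following two definitions are exact; see the lemmas below.
\<close>

definition L_CC_10 :: "nat \<Rightarrow> nat" where
  "L_CC_10 k = (512*k^5 + 1280*k^4 + 6560*k^3 + 7600*k^2 + 4180*k + 1344) div 3125"

definition gens_10 :: "int \<Rightarrow> int set" where
  "gens_10 k =
     {1,
      (128*k^4 + 64*k^3 + 1112*k^2 - 1224*k - 1557) div 625,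
      (256*k^4 + 448*k^3 + 2944*k^2 + 1592*k + 271) div 625,
      (256*k^4 + 608*k^3 + 3104*k^2 + 3062*k + 726) div 625,
      (384*k^4 + 672*k^3 + 4216*k^2 + 2338*k - 456) div 625}"

lemma L_CC_10_exact:
  assumes "[k = 3] (mod 5)"
  shows "real (L_CC_10 k) =
    (512 * real k^5 + 1280 * real k^4 + 6560 * real k^3 + 7600 * real k^2 + 4180 * real k + 1344) / 3125"
proof -
  define q where "q = k div 5"
  have k: "k = 5 * q + 3"
    using assms unfolding q_def cong_def by presburger
  have "512*k^5 + 1280*k^4 + 6560*k^3 + 7600*k^2 + 4180*k + 1344 =
     3125 * (512*q^5 + 1792*q^4 + 2720*q^3 + 2192*q^2 + 916*q + 156)"
    unfolding k by algebra
  then have "3125 dvd 512*k^5 + 1280*k^4 + 6560*k^3 + 7600*k^2 + 4180*k + 1344"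
    by (metis dvd_triv_left)
  then show ?thesis
    unfolding L_CC_10_def by (subst real_of_nat_div) simp_all
qed

lemma gens_10_exact:
  fixes k :: int
  assumes "[k = 3] (mod 5)"
  shows
    "625 dvd 128*k^4 + 64*k^3 + 1112*k^2 - 1224*k - 1557"
    "625 dvd 256*k^4 + 448*k^3 + 2944*k^2 + 1592*k + 271"
    "625 dvd 256*k^4 + 608*k^3 + 3104*k^2 + 3062*k + 726"
    "625 dvd 384*k^4 + 672*k^3 + 4216*k^2 + 2338*k - 456"
proof -
  define q where "q = k div 5"
  have k: "k = 5 * q + 3"
    using assms unfolding q_def cong_def by presburger
  have
    "128*k^4 + 64*k^3 + 1112*k^2 - 1224*k - 1557 = 625 * (128*q^4 + 320*q^3 + 344*q^2 + 168*q + 27)"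
    "256*k^4 + 448*k^3 + 2944*k^2 + 1592*k + 271 = 625 * (256*q^4 + 704*q^3 + 832*q^2 + 472*q + 103)"
    "256*k^4 + 608*k^3 + 3104*k^2 + 3062*k + 726 = 625 * (256*q^4 + 736*q^3 + 896*q^2 + 526*q + 120)"
    "384*k^4 + 672*k^3 + 4216*k^2 + 2338*k - 456 = 625 * (384*q^4 + 1056*q^3 + 1240*q^2 + 698*q + 150)"
    unfolding k by algebra+
  then show
    "625 dvd 128*k^4 + 64*k^3 + 1112*k^2 - 1224*k - 1557"
    "625 dvd 256*k^4 + 448*k^3 + 2944*k^2 + 1592*k + 271"
    "625 dvd 256*k^4 + 608*k^3 + 3104*k^2 + 3062*k + 726"
    "625 dvd 384*k^4 + 672*k^3 + 4216*k^2 + 2338*k - 456"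
    by (metis dvd_triv_left)+
qed

end

theory Submission
  imports Defs
begin

text \<open>
  Write \<open>k = 5q + 3\<close>. Walks in the graph are vectors in \<open>\<int>\<^sup>5\<close> with their \<open>\<ell>\<^sub>1\<close> norm as length, taken modulo the
  lattice of all vectors orthogonal to the generators modulo \<open>n\<close>; the diameter is the covering radius
  of that lattice. It consists of the vectors \<open>v(w)\<close> with \<open>2v(w) = (4q + D)w - Aw\<close>, where all coordinates of
  \<open>w\<close> have the same parity, \<open>D = diag(3,2,3,3,3)\<close>, and \<open>A\<close> is an antisymmetric matrix whose nonzero entries are
  \<open>1\<close> and \<open>-1\<close>; the \<open>i\<close>-th row has \<open>D\<^sub>i\<close> of them. By antisymmetry every \<open>v(w)\<close> with \<open>w \<in> {1,-1}\<^sup>5\<close> has norm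
  \<open>10q + 7 = 2k + 1\<close>. If \<open>x\<close> is a shortest vector of its coset, subtracting sums of the vectors \<open>v(2e\<^sub>i)\<close>
  bounds its coordinates, and this places \<open>x\<close> in the box spanned by \<open>0\<close> and such a \<open>v(w)\<close>. Then the norms of
  \<open>x\<close> and \<open>x - v(w)\<close> add up to \<open>2k + 1\<close>, so \<open>x\<close> has norm at most \<open>k\<close>. Conversely \<open>(q+1,q+1,q+1,q,q)\<close> has norm \<open>k\<close>
  and is shortest in its coset: odd lattice vectors have norm at least \<open>2k + 1\<close>, and even ones cannot
  decrease its norm. The inequalities need \<open>q \<ge> 1\<close>; for \<open>q = 0\<close> the distances in the graph, which has \<open>156\<close> vertices, are computed.
\<close>


section \<open>Walks in a circulant graph as sums of signed generators\<close>

lemma awalk_circulant_imp_sum_list: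
  assumes "pre_digraph.awalk (with_proj (circulant n S)) u p v"
  shows "\<exists>xs. length xs = length p \<and> set xs \<subseteq> S \<union> uminus ` S \<and> [v - u = sum_list xs] (mod int n)"
proof -
  interpret wf_digraph "with_proj (circulant n S)" by (rule wf_digraph_circulant)
  show ?thesis using assms
  proof (induction p arbitrary: u)
    case Nil
    then show ?case by (auto simp: awalk_Nil_iff)
  next
    case (Cons e p)
    obtain i j where e: "e = (i, j)" by fastforce
    from Cons.prems have u: "u = i" and arc: "(i, j) \<in> parcs (circulant n S)" and walk: "awalk j p v"
      by (auto simp: awalk_Cons_iff e)
    from Cons.IH[OF walk] obtain xs where xs: "length xs = length p" "set xs \<subseteq> S \<union> uminus ` S"
      "[v - j = sum_list xs] (mod int n)" by blast
    from arc obtain g where g: "g \<in> S \<union> uminus ` S" "[j - i = g] (mod int n)"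
      by (auto simp: circulant_def)
    have "[(j - i) + (v - j) = g + sum_list xs] (mod int n)"
      using g(2) xs(3) by (rule cong_add)
    then show ?case
      using xs g by (intro exI[of _ "g # xs"]) (simp add: u)
  qed
qed

lemma sum_list_imp_awalk_circulant:
  assumes "n > 0" "u \<in> {0..<int n}" "v \<in> {0..<int n}" "set xs \<subseteq> S \<union> uminus ` S"
    "[v - u = sum_list xs] (mod int n)"
  shows "\<exists>p. length p = length xs \<and> pre_digraph.awalk (with_proj (circulant n S)) u p v"
proof -
  interpret wf_digraph "with_proj (circulant n S)" by (rule wf_digraph_circulant)
  show ?thesis using assms
  proof (induction xs arbitrary: u)
    case Nil
    then have "u = v"
      by (metis atLeastLessThan_iff cong_diff_iff_cong_0 cong_less_imp_eq_int sum_list.Nil cong_sym)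
    moreover have "v \<in> pverts (circulant n S)" using Nil.prems by (simp add: circulant_def)
    ultimately show ?case by (simp add: awalk_Nil_iff)
  next
    case (Cons g xs)
    define j where "j = (u + g) mod int n"
    have j: "j \<in> {0..<int n}" using Cons.prems by (simp add: j_def)
    have jug: "[j - u = g] (mod int n)"
      unfolding j_def cong_def by (simp add: mod_diff_left_eq)
    have "[(v - u) - (j - u) = sum_list (g # xs) - g] (mod int n)"
      using Cons.prems(5) jug by (rule cong_diff)
    then have "[v - j = sum_list xs] (mod int n)" by simp
    with Cons.IH[of j] Cons.prems j obtain p where p: "length p = length xs" "awalk j p v" by auto
    have "(u, j) \<in> parcs (circulant n S)"
      using Cons.prems j jug by (force simp: circulant_def)
    with p show ?case
      by (intro exI[of _ "(u, j) # p"]) (auto simp: awalk_Cons_iff)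
  qed
qed

text \<open>Whether a walk of given length leads from \<open>u\<close> to \<open>v\<close> depends
  only on \<open>v - u\<close> modulo \<open>n\<close>. So the upper bound is a statement about
  residues, and for the lower bound a single residue \<open>d\<close>, seen from the vertex 0,
  suffices.\<close>

lemma graph_diameter_circulant_eqI:
  assumes n: "n > 0"
    and upper: "\<And>d. \<exists>xs. length xs \<le> k \<and> set xs \<subseteq> S \<union> uminus ` S \<and> [d = sum_list xs] (mod int n)"
    and lower: "\<And>xs. set xs \<subseteq> S \<union> uminus ` S \<Longrightarrow> [d = sum_list xs] (mod int n) \<Longrightarrow> k \<le> length xs"
  shows "graph_diameter (with_proj (circulant n S)) = ereal (real k)"
proof -
  let ?G = "with_proj (circulant n S)"
  have dist: "graph_dist ?G u v = (INF p \<in> {p. pre_digraph.awalk ?G u p v}. ereal (real (length p)))" for u v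
    by (rule graph_dist_eq_INF_length[OF wf_digraph_circulant])
  have verts: "verts ?G = {0..<int n}" by (simp add: circulant_def)
  have "graph_dist ?G u v \<le> ereal (real k)" if "u \<in> verts ?G" "v \<in> verts ?G" for u v
  proof -
    obtain xs where xs: "length xs \<le> k" "set xs \<subseteq> S \<union> uminus ` S" "[v - u = sum_list xs] (mod int n)"
      using upper by blast
    then obtain p where p: "length p = length xs" "pre_digraph.awalk ?G u p v"
      using sum_list_imp_awalk_circulant[OF n, of u v xs S] \<open>u \<in> _\<close> \<open>v \<in> _\<close> unfolding verts by blast
    show ?thesis unfolding dist
      by (rule INF_lower2[of p]) (use p xs in auto)
  qed
  moreover have "ereal (real k) \<le> graph_dist ?G 0 (d mod int n)"
    unfolding dist
  proof (rule INF_greatest)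
    fix p assume "p \<in> {p. pre_digraph.awalk ?G 0 p (d mod int n)}"
    then obtain xs where "length xs = length p" "set xs \<subseteq> S \<union> uminus ` S" "[d = sum_list xs] (mod int n)"
      using awalk_circulant_imp_sum_list[of n S 0 p "d mod int n"] by (auto simp: cong_def)
    then show "ereal (real k) \<le> ereal (real (length p))" using lower by force
  qed
  moreover have "0 \<in> verts ?G" "d mod int n \<in> verts ?G" unfolding verts using n by auto
  ultimately show ?thesis
    unfolding graph_diameter_def
    by (intro antisym SUP_least SUP_upper2[of "(0, d mod int n)"]) auto
qed

section \<open>Words in five generators as integer vectors\<close>

text \<open>The vector collects signed multiplicities of the letters. Opposite letters cancel, so
  its norm may be smaller than the length of the word.\<close>

lemma sum_list_five_generators:
  fixes g1 :: int
  assumes "set xs \<subseteq> {g1,g2,g3,g4,g5} \<union> uminus ` {g1,g2,g3,g4,g5}"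
  shows "\<exists>x1 x2 x3 x4 x5. sum_list xs = x1*g1 + x2*g2 + x3*g3 + x4*g4 + x5*g5 \<and>
    \<bar>x1\<bar> + \<bar>x2\<bar> + \<bar>x3\<bar> + \<bar>x4\<bar> + \<bar>x5\<bar> \<le> int (length xs)"
  using assms
proof (induction xs)
  case Nil
  show ?case by (intro exI[of _ 0]) simp
next
  case (Cons g xs)
  then obtain x1 x2 x3 x4 x5 where x: "sum_list xs = x1*g1 + x2*g2 + x3*g3 + x4*g4 + x5*g5"
    "\<bar>x1\<bar> + \<bar>x2\<bar> + \<bar>x3\<bar> + \<bar>x4\<bar> + \<bar>x5\<bar> \<le> int (length xs)" by auto
  have "\<exists>c1 c2 c3 c4 c5. g = c1*g1 + c2*g2 + c3*g3 + c4*g4 + c5*g5 \<and>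
      \<bar>c1\<bar> + \<bar>c2\<bar> + \<bar>c3\<bar> + \<bar>c4\<bar> + \<bar>c5\<bar> \<le> 1"
    (is "\<exists>c1 c2 c3 c4 c5. ?P c1 c2 c3 c4 c5")
  proof -
    have "?P 1 0 0 0 0 \<or> ?P (-1) 0 0 0 0 \<or> ?P 0 1 0 0 0 \<or> ?P 0 (-1) 0 0 0 \<or> ?P 0 0 1 0 0 \<or> ?P 0 0 (-1) 0 0 \<or>
      ?P 0 0 0 1 0 \<or> ?P 0 0 0 (-1) 0 \<or> ?P 0 0 0 0 1 \<or> ?P 0 0 0 0 (-1)"
      using Cons.prems by auto
    then show ?thesis by blast
  qed
  then obtain c1 c2 c3 c4 c5 where c: "?P c1 c2 c3 c4 c5" by blast
  have "sum_list (g # xs) = (x1+c1)*g1 + (x2+c2)*g2 + (x3+c3)*g3 + (x4+c4)*g4 + (x5+c5)*g5"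
    using x(1) c by (simp add: distrib_right)
  moreover have "\<bar>x1+c1\<bar> + \<bar>x2+c2\<bar> + \<bar>x3+c3\<bar> + \<bar>x4+c4\<bar> + \<bar>x5+c5\<bar> \<le> int (length (g # xs))"
  proof -
    have bound: "a1 \<le> b1 + d1 \<Longrightarrow> a2 \<le> b2 + d2 \<Longrightarrow> a3 \<le> b3 + d3 \<Longrightarrow> a4 \<le> b4 + d4 \<Longrightarrow> a5 \<le> b5 + d5 \<Longrightarrow>
        l = m + 1 \<Longrightarrow> b1 + b2 + b3 + b4 + b5 \<le> m \<Longrightarrow> d1 + d2 + d3 + d4 + d5 \<le> 1 \<Longrightarrow>
        a1 + a2 + a3 + a4 + a5 \<le> l" for a1 a2 a3 a4 a5 b1 b2 b3 b4 b5 d1 d2 d3 d4 d5 l m :: int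
      by linarith
    note abs_triangle_ineq[of x1 c1] abs_triangle_ineq[of x2 c2] abs_triangle_ineq[of x3 c3]
      abs_triangle_ineq[of x4 c4] abs_triangle_ineq[of x5 c5]
    moreover have "int (length (g # xs)) = int (length xs) + 1" by simp
    moreover note x(2) conjunct2[OF c]
    ultimately show ?thesis by (rule bound)
  qed
  ultimately show ?case by blast
qed

lemma ex_sum_list_multiple:
  fixes g x :: int
  shows "\<exists>xs. int (length xs) = \<bar>x\<bar> \<and> set xs \<subseteq> {g, - g} \<and> sum_list xs = x * g"
proof (cases "x \<ge> 0")
  case True
  then show ?thesis
    by (intro exI[of _ "replicate (nat x) g"]) (auto simp: sum_list_replicate)
next
  case False
  then show ?thesis
    by (intro exI[of _ "replicate (nat (-x)) (-g)"]) (auto simp: sum_list_replicate)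
qed

lemma ex_sum_list_five_generators:
  fixes g1 :: int
  shows "\<exists>xs. int (length xs) = \<bar>x1\<bar> + \<bar>x2\<bar> + \<bar>x3\<bar> + \<bar>x4\<bar> + \<bar>x5\<bar> \<and>
    set xs \<subseteq> {g1,g2,g3,g4,g5} \<union> uminus ` {g1,g2,g3,g4,g5} \<and>
    sum_list xs = x1*g1 + x2*g2 + x3*g3 + x4*g4 + x5*g5"
proof -
  obtain xs1 xs2 xs3 xs4 xs5 where
    "int (length xs1) = \<bar>x1\<bar> \<and> set xs1 \<subseteq> {g1, - g1} \<and> sum_list xs1 = x1 * g1"
    "int (length xs2) = \<bar>x2\<bar> \<and> set xs2 \<subseteq> {g2, - g2} \<and> sum_list xs2 = x2 * g2"
    "int (length xs3) = \<bar>x3\<bar> \<and> set xs3 \<subseteq> {g3, - g3} \<and> sum_list xs3 = x3 * g3"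
    "int (length xs4) = \<bar>x4\<bar> \<and> set xs4 \<subseteq> {g4, - g4} \<and> sum_list xs4 = x4 * g4"
    "int (length xs5) = \<bar>x5\<bar> \<and> set xs5 \<subseteq> {g5, - g5} \<and> sum_list xs5 = x5 * g5"
    using ex_sum_list_multiple[of x1 g1] ex_sum_list_multiple[of x2 g2] ex_sum_list_multiple[of x3 g3]
      ex_sum_list_multiple[of x4 g4] ex_sum_list_multiple[of x5 g5] by blast
  then show ?thesis
    by (intro exI[of _ "xs1 @ xs2 @ xs3 @ xs4 @ xs5"]) auto
qed

lemma graph_diameter_circulant_five_generators:
  fixes g1 :: int
  assumes "n > 0"
    and upper: "\<And>d. \<exists>x1 x2 x3 x4 x5. \<bar>x1\<bar> + \<bar>x2\<bar> + \<bar>x3\<bar> + \<bar>x4\<bar> + \<bar>x5\<bar> \<le> int k \<and>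
        [d = x1*g1 + x2*g2 + x3*g3 + x4*g4 + x5*g5] (mod int n)"
    and lower: "\<And>x1 x2 x3 x4 x5. [d = x1*g1 + x2*g2 + x3*g3 + x4*g4 + x5*g5] (mod int n) \<Longrightarrow>
        int k \<le> \<bar>x1\<bar> + \<bar>x2\<bar> + \<bar>x3\<bar> + \<bar>x4\<bar> + \<bar>x5\<bar>"
  shows "graph_diameter (with_proj (circulant n {g1,g2,g3,g4,g5})) = ereal (real k)"
proof (rule graph_diameter_circulant_eqI[OF \<open>n > 0\<close>])
  fix e
  obtain x1 x2 x3 x4 x5 where x: "\<bar>x1\<bar> + \<bar>x2\<bar> + \<bar>x3\<bar> + \<bar>x4\<bar> + \<bar>x5\<bar> \<le> int k"
    "[e = x1*g1 + x2*g2 + x3*g3 + x4*g4 + x5*g5] (mod int n)" using upper by blast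
  moreover obtain xs where "int (length xs) = \<bar>x1\<bar> + \<bar>x2\<bar> + \<bar>x3\<bar> + \<bar>x4\<bar> + \<bar>x5\<bar>"
    "set xs \<subseteq> {g1,g2,g3,g4,g5} \<union> uminus ` {g1,g2,g3,g4,g5}"
    "sum_list xs = x1*g1 + x2*g2 + x3*g3 + x4*g4 + x5*g5"
    using ex_sum_list_five_generators[of x1 x2 x3 x4 x5 g1 g2 g3 g4 g5] by blast
  ultimately show "\<exists>xs. length xs \<le> k \<and> set xs \<subseteq> {g1,g2,g3,g4,g5} \<union> uminus ` {g1,g2,g3,g4,g5} \<and> [e = sum_list xs] (mod int n)"
    by (intro exI[of _ xs]) simp
next
  fix xs assume xs: "set xs \<subseteq> {g1,g2,g3,g4,g5} \<union> uminus ` {g1,g2,g3,g4,g5}" "[d = sum_list xs] (mod int n)"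
  then obtain x1 x2 x3 x4 x5 where x: "sum_list xs = x1*g1 + x2*g2 + x3*g3 + x4*g4 + x5*g5"
    "\<bar>x1\<bar> + \<bar>x2\<bar> + \<bar>x3\<bar> + \<bar>x4\<bar> + \<bar>x5\<bar> \<le> int (length xs)"
    using sum_list_five_generators by blast
  with lower[of x1 x2 x3 x4 x5] xs show "k \<le> length xs" by simp
qed

section \<open>The covering bound, with the signs of the vector absorbed\<close>

text \<open>
  Coordinates 1, 3, 2, 4, 5 are called u, v, b, c, d, and the signs of \<open>x\<close> are absorbed into \<open>A\<close>, which then has
  the entries \<open>A\<^sub>u\<^sub>j = p, r, t\<close> and \<open>A\<^sub>v\<^sub>j = -sp, -sr, -st\<close> for \<open>j = b, c, d\<close>, and \<open>A\<^sub>c\<^sub>d = rt\<close>. The numbers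
  \<open>2m + 1\<close> and \<open>2m\<close> stand for \<open>2y - 4q - D\<close>, where \<open>y\<close> is the absolute value of the coordinate, and \<open>b = min y 1\<close>
  records whether it vanishes. At the vanishing coordinates the sign \<open>w\<close> is free; the moves
  by subsets of coordinates rule out conflicting demands on it.
\<close>

lemma sign_choice:
  fixes p r t s bu bv bb bc bd mu mv mb mc md :: int
  assumes signs: "p \<in> {1,-1}" "r \<in> {1,-1}" "t \<in> {1,-1}" "s \<in> {1,-1}"
    and b: "bu \<in> {0,1}" "bv \<in> {0,1}" "bb \<in> {0,1}" "bc \<in> {0,1}" "bd \<in> {0,1}"
    and gain: "\<And>ju jv jb jc jd :: int. {ju, jv, jb, jc, jd} \<subseteq> {0,1} \<Longrightarrow> ju + jv + jb + jc + jd \<le> 3 \<Longrightarrow>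
      ju * (2*mu+1) + jv * (2*mv+1) + jb * (2*mb) + jc * (2*mc+1) + jd * (2*md+1) \<le>
        (1 - ju) * (\<bar>bu - (- p*jb - r*jc - t*jd)\<bar> - bu) +
        (1 - jv) * (\<bar>bv - (s*p*jb + s*r*jc + s*t*jd)\<bar> - bv) +
        (1 - jb) * (\<bar>bb - (p*ju - s*p*jv)\<bar> - bb) +
        (1 - jc) * (\<bar>bc - (r*ju - s*r*jv - r*t*jd)\<bar> - bc) +
        (1 - jd) * (\<bar>bd - (t*ju - s*t*jv + r*t*jc)\<bar> - bd)"
  shows "\<exists>wu\<in>{1,-1}. \<exists>wv\<in>{1,-1}. \<exists>wb\<in>{1,-1}. \<exists>wc\<in>{1,-1}. \<exists>wd\<in>{1,-1}.
      (bu = 0 \<or> wu = 1 \<and> 2*mu+1 \<le> - p*wb - r*wc - t*wd) \<and>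
      (bv = 0 \<or> wv = 1 \<and> 2*mv+1 \<le> s*p*wb + s*r*wc + s*t*wd) \<and>
      (bb = 0 \<or> wb = 1 \<and> 2*mb \<le> p*wu - s*p*wv) \<and>
      (bc = 0 \<or> wc = 1 \<and> 2*mc+1 \<le> r*wu - s*r*wv - r*t*wd) \<and>
      (bd = 0 \<or> wd = 1 \<and> 2*md+1 \<le> t*wu - s*t*wv + r*t*wc)"
proof -
  \<comment> \<open>These are all moves of one or two coordinates and the four triples made of b,
    one of u, v and one of c, d. Once the signs and the vanishing coordinates are fixed, they are
    linear constraints on \<open>mu\<close>, ..., \<open>md\<close>.\<close>
  note g = gain[of 1 0 0 0 0]
    gain[of 0 1 0 0 0]
    gain[of 0 0 1 0 0]
    gain[of 0 0 0 1 0]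
    gain[of 0 0 0 0 1]
    gain[of 1 1 0 0 0]
    gain[of 1 0 1 0 0]
    gain[of 1 0 0 1 0]
    gain[of 1 0 0 0 1]
    gain[of 0 1 1 0 0]
    gain[of 0 1 0 1 0]
    gain[of 0 1 0 0 1]
    gain[of 0 0 1 1 0]
    gain[of 0 0 1 0 1]
    gain[of 0 0 0 1 1]
    gain[of 0 1 1 1 0]
    gain[of 0 1 1 0 1]
    gain[of 1 0 1 1 0]
    gain[of 1 0 1 0 1]
  have "bu = 0 \<or> bu = 1" "bv = 0 \<or> bv = 1" "bb = 0 \<or> bb = 1" "bc = 0 \<or> bc = 1" "bd = 0 \<or> bd = 1"
    "p = 1 \<or> p = -1" "r = 1 \<or> r = -1" "t = 1 \<or> t = -1" "s = 1 \<or> s = -1" using b signs by auto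
  then show ?thesis
    by (elim disjE; insert g; simp; smt (z3))
qed

text \<open>\<open>j\<close> tells whether the coordinate belongs to the moved set, and
  \<open>c\<close> is what the other moved coordinates contribute through the antisymmetric matrix.
  For \<open>j = 1\<close> the absolute value is \<open>D + c - y\<close>. For \<open>j = 0\<close>
  the triangle inequality replaces \<open>y\<close> by \<open>min y 1\<close>, so that only the
  vanishing of \<open>y\<close> matters. The summand \<open>j * c\<close> stands apart because its
  total over all coordinates is zero.\<close>

lemma subset_move_coordinate_le:
  fixes y D c j :: int
  assumes "y \<ge> 0" "j \<in> {0,1}" "j = 1 \<Longrightarrow> y \<le> D + c"
  shows "\<bar>y - (D*j + c)\<bar> \<le> y + j * (D - 2*y) + j * c + (1 - j) * (\<bar>min y 1 - c\<bar> - min y 1)"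
  using assms by auto

text \<open>The last hypothesis places \<open>2*y\<close> between 0 and \<open>D*w + c\<close>, a
  number of absolute value \<open>D + w * c\<close>; distances along a line add up.\<close>

lemma sign_move_coordinate_le:
  fixes y D c w :: int
  assumes "y \<ge> 0" "w \<in> {1,-1}" "\<bar>c\<bar> \<le> D" "min y 1 = 0 \<or> w = 1 \<and> 2*y - D \<le> c"
  shows "\<bar>2*y - (D*w + c)\<bar> \<le> D + w * c - 2*y"
  using assms by auto

text \<open>\<open>minimal\<close> says that a vector with absolute values \<open>yu\<close>, ...,
  \<open>yd\<close> is shortest in its coset, with everything doubled to avoid halves. The signs
  \<open>p\<close>, \<open>r\<close>, \<open>t\<close>, \<open>s\<close> are what remains in the
  matrix once the signs of the coordinates are moved into it.\<close>

lemma gauged_covering: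
  fixes q yu yv yb yc yd p r t s :: int
  assumes q: "q \<ge> 1"
    and y: "yu \<ge> 0" "yv \<ge> 0" "yb \<ge> 0" "yc \<ge> 0" "yd \<ge> 0"
    and signs: "p \<in> {1,-1}" "r \<in> {1,-1}" "t \<in> {1,-1}" "s \<in> {1,-1}"
    and minimal: "\<And>wu wv wb wc wd :: int.
      even wv = even wu \<Longrightarrow> even wb = even wu \<Longrightarrow> even wc = even wu \<Longrightarrow> even wd = even wu \<Longrightarrow>
      2 * (yu + yv + yb + yc + yd) \<le>
        \<bar>2*yu - ((4*q+3)*wu + (- p*wb - r*wc - t*wd))\<bar> + \<bar>2*yv - ((4*q+3)*wv + (s*p*wb + s*r*wc + s*t*wd))\<bar> +
        \<bar>2*yb - ((4*q+2)*wb + (p*wu - s*p*wv))\<bar> + \<bar>2*yc - ((4*q+3)*wc + (r*wu - s*r*wv - r*t*wd))\<bar> +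
        \<bar>2*yd - ((4*q+3)*wd + (t*wu - s*t*wv + r*t*wc))\<bar>"
  shows "yu + yv + yb + yc + yd \<le> 5*q + 3"
proof -
  have halve: "2*e \<le> 2*e1 + 2*e2 + 2*e3 + 2*e4 + 2*e5 \<Longrightarrow> e \<le> e1 + e2 + e3 + e4 + e5" for e e1 e2 e3 e4 e5 :: int
    by linarith
  have sum5_mono: "e \<le> e1 + e2 + e3 + e4 + e5 \<Longrightarrow> e1 \<le> f1 \<Longrightarrow> e2 \<le> f2 \<Longrightarrow> e3 \<le> f3 \<Longrightarrow> e4 \<le> f4 \<Longrightarrow> e5 \<le> f5 \<Longrightarrow>
      e \<le> f1 + f2 + f3 + f4 + f5" for e e1 e2 e3 e4 e5 f1 f2 f3 f4 f5 :: int
    by linarith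
  \<comment> \<open>For \<open>w = 2*j\<close> the parity conditions hold for every integer vector
    \<open>j\<close>, and the factor 2 cancels.\<close>
  have even_move: "yu + yv + yb + yc + yd \<le>
        \<bar>yu - ((4*q+3)*ju + (- p*jb - r*jc - t*jd))\<bar> + \<bar>yv - ((4*q+3)*jv + (s*p*jb + s*r*jc + s*t*jd))\<bar> +
        \<bar>yb - ((4*q+2)*jb + (p*ju - s*p*jv))\<bar> + \<bar>yc - ((4*q+3)*jc + (r*ju - s*r*jv - r*t*jd))\<bar> +
        \<bar>yd - ((4*q+3)*jd + (t*ju - s*t*jv + r*t*jc))\<bar>" for ju jv jb jc jd
  proof -
    have "2 * (yu + yv + yb + yc + yd) \<le>
        \<bar>2 * (yu - ((4*q+3)*ju + (- p*jb - r*jc - t*jd)))\<bar> + \<bar>2 * (yv - ((4*q+3)*jv + (s*p*jb + s*r*jc + s*t*jd)))\<bar> +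
        \<bar>2 * (yb - ((4*q+2)*jb + (p*ju - s*p*jv)))\<bar> + \<bar>2 * (yc - ((4*q+3)*jc + (r*ju - s*r*jv - r*t*jd)))\<bar> +
        \<bar>2 * (yd - ((4*q+3)*jd + (t*ju - s*t*jv + r*t*jc)))\<bar>"
      using minimal[of "2*jv" "2*ju" "2*jb" "2*jc" "2*jd"] by (simp add: algebra_simps)
    then show ?thesis unfolding abs_mult abs_numeral by (rule halve)
  qed
  have sign_le: "\<bar>a * b\<bar> = \<bar>b\<bar>" if "a \<in> {1,-1}" for a b :: int using that by auto
  have prods: "s*p \<in> {1,-1}" "s*r \<in> {1,-1}" "s*t \<in> {1,-1}" "r*t \<in> {1,-1}" using signs by auto
  note ab = sign_le[OF signs(1)] sign_le[OF signs(2)] sign_le[OF signs(3)]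
    sign_le[OF prods(1)] sign_le[OF prods(2)] sign_le[OF prods(3)] sign_le[OF prods(4)]
  have tri3: "\<bar>a\<bar> \<le> a' \<Longrightarrow> \<bar>b\<bar> \<le> b' \<Longrightarrow> \<bar>c\<bar> \<le> c' \<Longrightarrow>
      \<bar>- a - b - c\<bar> \<le> a' + b' + c' \<and> \<bar>a + b + c\<bar> \<le> a' + b' + c' \<and> \<bar>a - b - c\<bar> \<le> a' + b' + c' \<and>
      \<bar>a - b + c\<bar> \<le> a' + b' + c' \<and> \<bar>a - b\<bar> \<le> a' + b'"
    for a b c a' b' c' :: int by (simp add: abs_le_iff)
  have cross: "\<bar>- p*wb - r*wc - t*wd\<bar> \<le> \<bar>wb\<bar> + \<bar>wc\<bar> + \<bar>wd\<bar>" "\<bar>s*p*wb + s*r*wc + s*t*wd\<bar> \<le> \<bar>wb\<bar> + \<bar>wc\<bar> + \<bar>wd\<bar>"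
    "\<bar>p*wu - s*p*wv\<bar> \<le> \<bar>wu\<bar> + \<bar>wv\<bar>" "\<bar>r*wu - s*r*wv - r*t*wd\<bar> \<le> \<bar>wu\<bar> + \<bar>wv\<bar> + \<bar>wd\<bar>"
    "\<bar>t*wu - s*t*wv + r*t*wc\<bar> \<le> \<bar>wu\<bar> + \<bar>wv\<bar> + \<bar>wc\<bar>" for wu wv wb wc wd
    using tri3[of "p*wb" "\<bar>wb\<bar>" "r*wc" "\<bar>wc\<bar>" "t*wd" "\<bar>wd\<bar>"] tri3[of "s*p*wb" "\<bar>wb\<bar>" "s*r*wc" "\<bar>wc\<bar>" "s*t*wd" "\<bar>wd\<bar>"]
      tri3[of "p*wu" "\<bar>wu\<bar>" "s*p*wv" "\<bar>wv\<bar>" 0 0] tri3[of "r*wu" "\<bar>wu\<bar>" "s*r*wv" "\<bar>wv\<bar>" "r*t*wd" "\<bar>wd\<bar>"]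
      tri3[of "t*wu" "\<bar>wu\<bar>" "s*t*wv" "\<bar>wv\<bar>" "r*t*wc" "\<bar>wc\<bar>"]
    by (simp_all only: ab order.refl minus_mult_left abs_zero simp_thms)
  \<comment> \<open>Moving one coordinate with diagonal entry \<open>4*q + D\<close> changes exactly
    \<open>D\<close> others, by 1 each. As the norm cannot drop, \<open>2*y \<le> 4*q + 2*D\<close>;
    the alternative \<open>y > 4*q + D\<close> would force \<open>q \<le> 0\<close>. The arguments
    of \<open>even_move\<close> stand in the order u, b, c, d, v.\<close>
  have rough: "yu \<le> 2*q + 3" "yv \<le> 2*q + 3" "yb \<le> 2*q + 2" "yc \<le> 2*q + 3" "yd \<le> 2*q + 3"
  proof -
    have n1: "\<bar>a - e\<bar> \<le> a + 1 \<and> \<bar>a + e\<bar> \<le> a + 1" if "a \<ge> 0" "e \<in> {1,-1}" for a e :: int using that by auto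
    note N = n1[OF y(1) signs(1)] n1[OF y(1) signs(2)] n1[OF y(1) signs(3)]
      n1[OF y(2) prods(1)] n1[OF y(2) prods(2)] n1[OF y(2) prods(3)]
      n1[OF y(3) signs(1)] n1[OF y(3) prods(1)]
      n1[OF y(4) signs(2)] n1[OF y(4) prods(2)] n1[OF y(4) prods(4)]
      n1[OF y(5) signs(3)] n1[OF y(5) prods(3)] n1[OF y(5) prods(4)]
    have "yu + yv + yb + yc + yd \<le> \<bar>yu - (4*q+3)\<bar> + yv + (yb + 1) + (yc + 1) + (yd + 1)"
      by (rule sum5_mono[OF even_move[of 1 0 0 0 0]]) (simp_all add: N y)
    then show "yu \<le> 2*q + 3" using q by linarith
    have "yu + yv + yb + yc + yd \<le> yu + \<bar>yv - (4*q+3)\<bar> + (yb + 1) + (yc + 1) + (yd + 1)"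
      by (rule sum5_mono[OF even_move[of 0 0 0 0 1]]) (simp_all add: N y)
    then show "yv \<le> 2*q + 3" using q by linarith
    have "yu + yv + yb + yc + yd \<le> (yu + 1) + (yv + 1) + \<bar>yb - (4*q+2)\<bar> + yc + yd"
      by (rule sum5_mono[OF even_move[of 0 1 0 0 0]]) (simp_all add: N y)
    then show "yb \<le> 2*q + 2" using q by linarith
    have "yu + yv + yb + yc + yd \<le> (yu + 1) + (yv + 1) + yb + \<bar>yc - (4*q+3)\<bar> + (yd + 1)"
      by (rule sum5_mono[OF even_move[of 0 0 1 0 0]]) (simp_all add: N y)
    then show "yc \<le> 2*q + 3" using q by linarith
    have "yu + yv + yb + yc + yd \<le> (yu + 1) + (yv + 1) + yb + (yc + 1) + \<bar>yd - (4*q+3)\<bar>"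
      by (rule sum5_mono[OF even_move[of 0 0 0 1 0]]) (simp_all add: N y)
    then show "yd \<le> 2*q + 3" using q by linarith
  qed
  let ?mu = "yu - 2*q - 2" and ?mv = "yv - 2*q - 2" and ?mb = "yb - 2*q - 1" and ?mc = "yc - 2*q - 2" and ?md = "yd - 2*q - 2"
  let ?b = "\<lambda>y::int. min y 1"
  have gain: "ju * (2*?mu+1) + jv * (2*?mv+1) + jb * (2*?mb) + jc * (2*?mc+1) + jd * (2*?md+1) \<le>
      (1 - ju) * (\<bar>?b yu - (- p*jb - r*jc - t*jd)\<bar> - ?b yu) +
      (1 - jv) * (\<bar>?b yv - (s*p*jb + s*r*jc + s*t*jd)\<bar> - ?b yv) +
      (1 - jb) * (\<bar>?b yb - (p*ju - s*p*jv)\<bar> - ?b yb) +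
      (1 - jc) * (\<bar>?b yc - (r*ju - s*r*jv - r*t*jd)\<bar> - ?b yc) +
      (1 - jd) * (\<bar>?b yd - (t*ju - s*t*jv + r*t*jc)\<bar> - ?b yd)"
    if "{ju, jv, jb, jc, jd} \<subseteq> {0,1}" and three: "ju + jv + jb + jc + jd \<le> 3" for ju jv jb jc jd :: int
  proof -
    have j: "ju \<in> {0,1}" "jv \<in> {0,1}" "jb \<in> {0,1}" "jc \<in> {0,1}" "jd \<in> {0,1}" using that by auto
    then have pos: "ju \<ge> 0" "jv \<ge> 0" "jb \<ge> 0" "jc \<ge> 0" "jd \<ge> 0" by auto
    then have absj: "\<bar>ju\<bar> = ju" "\<bar>jv\<bar> = jv" "\<bar>jb\<bar> = jb" "\<bar>jc\<bar> = jc" "\<bar>jd\<bar> = jd" by auto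
    note cr = cross(1)[of jb jc jd] cross(2)[of jb jc jd] cross(3)[of ju jv] cross(4)[of ju jv jd] cross(5)[of ju jv jc]
    note cr' = cr[unfolded absj]
    \<comment> \<open>With at most three moved coordinates the other two contribute at most 2 in
      absolute value, and \<open>2*q + 3 \<le> 4*q + 3 - 2\<close> because
      \<open>q \<ge> 1\<close>.\<close>
    have room: "yu \<le> 4*q+3 + (- p*jb - r*jc - t*jd)" if "ju = 1" using cr'(1) rough q three pos that by linarith
    have room2: "yv \<le> 4*q+3 + (s*p*jb + s*r*jc + s*t*jd)" if "jv = 1" using cr'(2) rough q three pos that by linarith
    have room3: "yb \<le> 4*q+2 + (p*ju - s*p*jv)" if "jb = 1" using cr'(3) rough q three pos that by linarith
    have room4: "yc \<le> 4*q+3 + (r*ju - s*r*jv - r*t*jd)" if "jc = 1" using cr'(4) rough q three pos that by linarith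
    have room5: "yd \<le> 4*q+3 + (t*ju - s*t*jv + r*t*jc)" if "jd = 1" using cr'(5) rough q three pos that by linarith
    have antisym: "ju*(- p*jb - r*jc - t*jd) + jv*(s*p*jb + s*r*jc + s*t*jd) + jb*(p*ju - s*p*jv) +
        jc*(r*ju - s*r*jv - r*t*jd) + jd*(t*ju - s*t*jv + r*t*jc) = 0"
      by algebra
    have own: "ju * (2*?mu+1) = - (ju * (4*q+3 - 2*yu))" "jv * (2*?mv+1) = - (jv * (4*q+3 - 2*yv))"
      "jb * (2*?mb) = - (jb * (4*q+2 - 2*yb))" "jc * (2*?mc+1) = - (jc * (4*q+3 - 2*yc))"
      "jd * (2*?md+1) = - (jd * (4*q+3 - 2*yd))" by algebra+
    have collect: "yu + yv + yb + yc + yd \<le> (yu + a1 + c1 + e1) + (yv + a2 + c2 + e2) + (yb + a3 + c3 + e3) +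
        (yc + a4 + c4 + e4) + (yd + a5 + c5 + e5) \<Longrightarrow> c1 + c2 + c3 + c4 + c5 = 0 \<Longrightarrow>
        - a1 + - a2 + - a3 + - a4 + - a5 \<le> e1 + e2 + e3 + e4 + e5"
      for a1 a2 a3 a4 a5 c1 c2 c3 c4 c5 e1 e2 e3 e4 e5 :: int
      by linarith
    show ?thesis
      unfolding own
      by (rule collect[OF sum5_mono[OF even_move[of ju jb jc jd jv]
        subset_move_coordinate_le[OF y(1) j(1) room] subset_move_coordinate_le[OF y(2) j(2) room2]
        subset_move_coordinate_le[OF y(3) j(3) room3] subset_move_coordinate_le[OF y(4) j(4) room4]
        subset_move_coordinate_le[OF y(5) j(5) room5]] antisym])
  qed
  have b01: "?b a \<in> {0,1}" if "a \<ge> 0" for a using that by auto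
  obtain wu wv wb wc wd where w: "wu \<in> {1,-1}" "wv \<in> {1,-1}" "wb \<in> {1,-1}" "wc \<in> {1,-1}" "wd \<in> {1,-1}"
    and box: "?b yu = 0 \<or> wu = 1 \<and> 2*?mu+1 \<le> - p*wb - r*wc - t*wd"
      "?b yv = 0 \<or> wv = 1 \<and> 2*?mv+1 \<le> s*p*wb + s*r*wc + s*t*wd"
      "?b yb = 0 \<or> wb = 1 \<and> 2*?mb \<le> p*wu - s*p*wv"
      "?b yc = 0 \<or> wc = 1 \<and> 2*?mc+1 \<le> r*wu - s*r*wv - r*t*wd"
      "?b yd = 0 \<or> wd = 1 \<and> 2*?md+1 \<le> t*wu - s*t*wv + r*t*wc"
    using sign_choice[OF signs b01[OF y(1)] b01[OF y(2)] b01[OF y(3)] b01[OF y(4)] b01[OF y(5)] gain] by blast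
  have absw: "\<bar>wu\<bar> = 1" "\<bar>wv\<bar> = 1" "\<bar>wb\<bar> = 1" "\<bar>wc\<bar> = 1" "\<bar>wd\<bar> = 1" using w by auto
  note cr = cross(1)[of wb wc wd] cross(2)[of wb wc wd] cross(3)[of wu wv] cross(4)[of wu wv wd] cross(5)[of wu wv wc]
  have small: "\<bar>- p*wb - r*wc - t*wd\<bar> \<le> 4*q+3" "\<bar>s*p*wb + s*r*wc + s*t*wd\<bar> \<le> 4*q+3" "\<bar>p*wu - s*p*wv\<bar> \<le> 4*q+2"
    "\<bar>r*wu - s*r*wv - r*t*wd\<bar> \<le> 4*q+3" "\<bar>t*wu - s*t*wv + r*t*wc\<bar> \<le> 4*q+3"
    by (rule order_trans[OF cr(1)] order_trans[OF cr(2)] order_trans[OF cr(3)] order_trans[OF cr(4)]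
        order_trans[OF cr(5)], use q absw in simp)+
  have shift: "2*(a - 2*q - 2) + 1 = 2*a - (4*q+3)" "2*(a - 2*q - 1) = 2*a - (4*q+2)" for a by simp_all
  have odd: "even a = even wu" if "a \<in> {1,-1}" for a :: int using that w(1) by auto
  have antisym: "wu*(- p*wb - r*wc - t*wd) + wv*(s*p*wb + s*r*wc + s*t*wd) + wb*(p*wu - s*p*wv) +
      wc*(r*wu - s*r*wv - r*t*wd) + wd*(t*wu - s*t*wv + r*t*wc) = 0"
    by algebra
  \<comment> \<open>The diagonal entries add up to \<open>20*q + 14\<close>, which bounds four times
    the norm; integrality rounds \<open>5*q + 7/2\<close> down to \<open>5*q + 3\<close>.\<close>
  have finish: "2 * (yu + yv + yb + yc + yd) \<le> (4*q+3 + c1 - 2*yu) + (4*q+3 + c2 - 2*yv) + (4*q+2 + c3 - 2*yb) +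
      (4*q+3 + c4 - 2*yc) + (4*q+3 + c5 - 2*yd) \<Longrightarrow> c1 + c2 + c3 + c4 + c5 = 0 \<Longrightarrow> ?thesis"
    for c1 c2 c3 c4 c5 by presburger
  note box' = box[unfolded shift]
  show ?thesis
    using sum5_mono[OF minimal[OF odd[OF w(2)] odd[OF w(3)] odd[OF w(4)] odd[OF w(5)]]
      sign_move_coordinate_le[OF y(1) w(1) small(1) box'(1)] sign_move_coordinate_le[OF y(2) w(2) small(2) box'(2)]
      sign_move_coordinate_le[OF y(3) w(3) small(3) box'(3)] sign_move_coordinate_le[OF y(4) w(4) small(4) box'(4)]
      sign_move_coordinate_le[OF y(5) w(5) small(5) box'(5)]] antisym
    by (rule finish)
qed

section \<open>The lattice of the generators\<close>

text \<open>The order, and below it the generators, after substituting \<open>k = 5*q + 3\<close>,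
  which clears the denominators.\<close>

definition circ_order :: "int \<Rightarrow> int" where
  "circ_order q = 512*q^5 + 1792*q^4 + 2720*q^3 + 2192*q^2 + 916*q + 156"

definition gen2 :: "int \<Rightarrow> int" where "gen2 q = 128*q^4 + 320*q^3 + 344*q^2 + 168*q + 27"
definition gen3 :: "int \<Rightarrow> int" where "gen3 q = 256*q^4 + 704*q^3 + 832*q^2 + 472*q + 103"
definition gen4 :: "int \<Rightarrow> int" where "gen4 q = 256*q^4 + 736*q^3 + 896*q^2 + 526*q + 120"
definition gen5 :: "int \<Rightarrow> int" where "gen5 q = 384*q^4 + 1056*q^3 + 1240*q^2 + 698*q + 150"

lemmas circ_defs = circ_order_def gen2_def gen3_def gen4_def gen5_def

text \<open>The vector on the left is 2v(w). If all \<open>wi\<close> have the same parity, the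
  factor \<open>w2 + 2*w3 + 2*w4 + 3*w5\<close> is even, and halving shows that v(w) is orthogonal
  to the generators modulo the order.\<close>

lemma generators_lattice_eq:
  "((4*q+3)*w1 - w2 - w4 + w5) + ((4*q+2)*w2 + w1 - w3) * gen2 q + ((4*q+3)*w3 + w2 + w4 - w5) * gen3 q +
     ((4*q+3)*w4 + w1 - w3 + w5) * gen4 q + ((4*q+3)*w5 - w1 + w3 - w4) * gen5 q =
   circ_order q * (w2 + 2*w3 + 2*w4 + 3*w5)"
  unfolding circ_defs by algebra

text \<open>The converse inclusion: every vector orthogonal to the generators modulo the order is
  some v(w).\<close>

lemma generators_kernel_lattice:
  assumes "x1 + x2 * gen2 q + x3 * gen3 q + x4 * gen4 q + x5 * gen5 q = circ_order q * m"
  obtains w1 w2 w3 w4 w5 where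
    "even w2 = even w1" "even w3 = even w1" "even w4 = even w1" "even w5 = even w1"
    "2*x1 = (4*q+3)*w1 - w2 - w4 + w5" "2*x2 = (4*q+2)*w2 + w1 - w3" "2*x3 = (4*q+3)*w3 + w2 + w4 - w5"
    "2*x4 = (4*q+3)*w4 + w1 - w3 + w5" "2*x5 = (4*q+3)*w5 - w1 + w3 - w4"
proof
  \<comment> \<open>The coefficients of \<open>m\<close> and \<open>x\<^sub>i\<close> are the lattice coordinates of \<open>(n,0,0,0,0)\<close> and \<open>e\<^sub>i - g\<^sub>i e\<^sub>1\<close>.\<close>
  let ?w1 = "2*((128*q^4 + 352*q^3 + 392*q^2 + 204*q + 41)*m - (32*q^3 + 56*q^2 + 38*q + 7)*x2 -
    (64*q^3 + 128*q^2 + 100*q + 27)*x3 - (64*q^3 + 136*q^2 + 110*q + 32)*x4 - (96*q^3 + 192*q^2 + 148*q + 40)*x5) + x4 + x5"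
  let ?w2 = "2*(- (32*q^3 + 72*q^2 + 56*q + 15)*m + (8*q^2 + 10*q + 3)*x2 +
    (16*q^2 + 24*q + 10)*x3 + (16*q^2 + 26*q + 11)*x4 + (24*q^2 + 36*q + 14)*x5) + x4 + x5"
  let ?w3 = "2*((24*q^2 + 32*q + 11)*m - (6*q + 2)*x2 - (12*q + 7)*x3 - (12*q + 9)*x4 - (18*q + 11)*x5) + x4 + x5"
  let ?w4 = "2*(- (32*q^3 + 72*q^2 + 52*q + 12)*m + (8*q^2 + 10*q + 2)*x2 +
    (16*q^2 + 24*q + 8)*x3 + (16*q^2 + 26*q + 9)*x4 + (24*q^2 + 36*q + 11)*x5) + x4 + x5"
  let ?w5 = "2*((32*q^3 + 56*q^2 + 32*q + 6)*m - (8*q^2 + 6*q + 1)*x2 -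
    (16*q^2 + 16*q + 4)*x3 - (16*q^2 + 18*q + 5)*x4 - (24*q^2 + 24*q + 6)*x5) + x4 + x5"
  \<comment> \<open>Every coordinate of \<open>w\<close> has the parity of
    \<open>x4 + x5\<close>.\<close>
  have parity: "even (2*a + x4 + x5) = even (x4 + x5)" for a by (simp add: add.assoc)
  show "even ?w2 = even ?w1" "even ?w3 = even ?w1" "even ?w4 = even ?w1" "even ?w5 = even ?w1"
    by (simp_all only: parity)
  have x1: "x1 = circ_order q * m - x2 * gen2 q - x3 * gen3 q - x4 * gen4 q - x5 * gen5 q"
    using assms by simp
  show "2*x1 = (4*q+3)*?w1 - ?w2 - ?w4 + ?w5" unfolding x1 circ_defs by algebra
  show "2*x2 = (4*q+2)*?w2 + ?w1 - ?w3" by algebra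
  show "2*x3 = (4*q+3)*?w3 + ?w2 + ?w4 - ?w5" by algebra
  show "2*x4 = (4*q+3)*?w4 + ?w1 - ?w3 + ?w5" by algebra
  show "2*x5 = (4*q+3)*?w5 - ?w1 + ?w3 - ?w4" by algebra
qed

section \<open>Every residue has a representative of norm at most \<open>5*q + 3\<close>\<close>

lemma five_generators_covering:
  assumes q: "q \<ge> 1"
  shows "\<exists>x1 x2 x3 x4 x5. \<bar>x1\<bar> + \<bar>x2\<bar> + \<bar>x3\<bar> + \<bar>x4\<bar> + \<bar>x5\<bar> \<le> 5*q + 3 \<and>
    [d = x1*1 + x2 * gen2 q + x3 * gen3 q + x4 * gen4 q + x5 * gen5 q] (mod circ_order q)"
proof -
  define P where "P = (\<lambda>(x1,x2,x3,x4,x5). [d = x1 + x2 * gen2 q + x3 * gen3 q + x4 * gen4 q + x5 * gen5 q] (mod circ_order q))"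
  define norm1 where "norm1 = (\<lambda>(x1,x2,x3,x4,x5::int). nat (\<bar>x1\<bar> + \<bar>x2\<bar> + \<bar>x3\<bar> + \<bar>x4\<bar> + \<bar>x5::int\<bar>))"
  have "P (d, 0, 0, 0, 0)" by (simp add: P_def)
  then obtain x where "P x" and least: "\<And>x'. P x' \<Longrightarrow> norm1 x \<le> norm1 x'"
    using ex_has_least_nat[of P "(d, 0, 0, 0, 0)" norm1] by blast
  obtain x1 x2 x3 x4 x5 where x: "x = (x1, x2, x3, x4, x5)" by (cases x) auto
  \<comment> \<open>Unlike \<open>sgn\<close>, this gives 0 the sign 1, so the value is always a
    unit.\<close>
  define sg where "sg = (\<lambda>a::int. if a < 0 then -1 else 1 :: int)"
  have sg: "sg a \<in> {1,-1}" "sg a * sg a = 1" "a = sg a * \<bar>a\<bar>" "\<bar>sg a * b\<bar> = \<bar>b\<bar>" for a b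
    by (auto simp: sg_def abs_mult)
  have sg2: "sg a * sg b \<in> {1,-1}" "- (sg a * sg b) \<in> {1,-1}" for a b using sg(1)[of a] sg(1)[of b] by auto
  \<comment> \<open>Conjugating the matrix by the signs of \<open>x\<close> turns its first row into
    products \<open>sg x1 * sg xi\<close> up to sign. These are \<open>p\<close>, \<open>r\<close>,
    \<open>t\<close>; with \<open>s = sg x1 * sg x3\<close> they determine all other entries, since
    squares of signs are 1. Coordinate 3 comes second, in the role of v.\<close>
  have "\<bar>x1\<bar> + \<bar>x3\<bar> + \<bar>x2\<bar> + \<bar>x4\<bar> + \<bar>x5\<bar> \<le> 5*q + 3"
  proof (rule gauged_covering[OF q abs_ge_zero abs_ge_zero abs_ge_zero abs_ge_zero abs_ge_zero,
        of "sg x1 * sg x2" "sg x1 * sg x4" "- (sg x1 * sg x5)" "sg x1 * sg x3", OF sg2(1) sg2(1) sg2(2) sg2(1)])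
    fix wu wv wb wc wd :: int
    assume par: "even wv = even wu" "even wb = even wu" "even wc = even wu" "even wd = even wu"
    define w1 w2 w3 w4 w5 where w: "w1 = sg x1 * wu" "w2 = sg x2 * wb" "w3 = sg x3 * wv" "w4 = sg x4 * wc" "w5 = sg x5 * wd"
    have "even w1 = even wu" "even w2 = even wu" "even w3 = even wu" "even w4 = even wu" "even w5 = even wu"
      using par by (auto simp: w sg_def)
    then have "even ((4*q+3)*w1 - w2 - w4 + w5)" "even ((4*q+2)*w2 + w1 - w3)" "even ((4*q+3)*w3 + w2 + w4 - w5)"
      "even ((4*q+3)*w4 + w1 - w3 + w5)" "even ((4*q+3)*w5 - w1 + w3 - w4)" "even (w2 + 2*w3 + 2*w4 + 3*w5)"
      by auto
    then obtain v1 v2 v3 v4 v5 m where v: "(4*q+3)*w1 - w2 - w4 + w5 = 2*v1" "(4*q+2)*w2 + w1 - w3 = 2*v2"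
      "(4*q+3)*w3 + w2 + w4 - w5 = 2*v3" "(4*q+3)*w4 + w1 - w3 + w5 = 2*v4" "(4*q+3)*w5 - w1 + w3 - w4 = 2*v5"
      and m: "w2 + 2*w3 + 2*w4 + 3*w5 = 2*m" by (elim evenE) blast
    have "2 * (v1 + v2 * gen2 q + v3 * gen3 q + v4 * gen4 q + v5 * gen5 q) = 2 * (circ_order q * m)"
      using generators_lattice_eq[of q w1 w2 w4 w5 w3] unfolding v m by (simp add: algebra_simps)
    then have shift: "(x1 - v1) + (x2 - v2) * gen2 q + (x3 - v3) * gen3 q + (x4 - v4) * gen4 q + (x5 - v5) * gen5 q =
      (x1 + x2 * gen2 q + x3 * gen3 q + x4 * gen4 q + x5 * gen5 q) - circ_order q * m"
      by (simp add: algebra_simps)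
    have "[a = a - circ_order q * m] (mod circ_order q)" for a by (simp add: cong_iff_dvd_diff)
    then have "P (x1 - v1, x2 - v2, x3 - v3, x4 - v4, x5 - v5)"
      using \<open>P x\<close> unfolding P_def x prod.case shift by (metis cong_trans)
    from least[OF this] have "\<bar>x1\<bar> + \<bar>x2\<bar> + \<bar>x3\<bar> + \<bar>x4\<bar> + \<bar>x5\<bar> \<le> \<bar>x1 - v1\<bar> + \<bar>x2 - v2\<bar> + \<bar>x3 - v3\<bar> + \<bar>x4 - v4\<bar> + \<bar>x5 - v5\<bar>"
      unfolding norm1_def x prod.case by (subst (asm) nat_le_eq_zle) simp_all
    then have "2 * (\<bar>x1\<bar> + \<bar>x3\<bar> + \<bar>x2\<bar> + \<bar>x4\<bar> + \<bar>x5\<bar>) \<le>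
        \<bar>2 * (x1 - v1)\<bar> + \<bar>2 * (x3 - v3)\<bar> + \<bar>2 * (x2 - v2)\<bar> + \<bar>2 * (x4 - v4)\<bar> + \<bar>2 * (x5 - v5)\<bar>"
      unfolding abs_mult abs_numeral by (simp only: distrib_left[symmetric] mult_le_cancel_left_pos zero_less_numeral ac_simps)
    \<comment> \<open>Each difference is a sign times the expression in
      \<open>gauged_covering\<close>, so the absolute values agree.\<close>
    moreover have
      "2 * (x1 - v1) = sg x1 * (2*\<bar>x1\<bar> - ((4*q+3)*wu + (- (sg x1 * sg x2)*wb - sg x1 * sg x4 *wc - - (sg x1 * sg x5)*wd)))"
      "2 * (x3 - v3) = sg x3 * (2*\<bar>x3\<bar> - ((4*q+3)*wv + (sg x1 * sg x3*(sg x1 * sg x2)*wb +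
          sg x1 * sg x3*(sg x1 * sg x4)*wc + sg x1 * sg x3* - (sg x1 * sg x5)*wd)))"
      "2 * (x2 - v2) = sg x2 * (2*\<bar>x2\<bar> - ((4*q+2)*wb + (sg x1 * sg x2*wu - sg x1 * sg x3*(sg x1 * sg x2)*wv)))"
      "2 * (x4 - v4) = sg x4 * (2*\<bar>x4\<bar> - ((4*q+3)*wc + (sg x1 * sg x4*wu -
          sg x1 * sg x3*(sg x1 * sg x4)*wv - sg x1 * sg x4* - (sg x1 * sg x5)*wd)))"
      "2 * (x5 - v5) = sg x5 * (2*\<bar>x5\<bar> - ((4*q+3)*wd + (- (sg x1 * sg x5)*wu -
          sg x1 * sg x3*- (sg x1 * sg x5)*wv + sg x1 * sg x4* - (sg x1 * sg x5)*wc)))"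
      using sg(2)[of x1] sg(2)[of x2] sg(2)[of x3] sg(2)[of x4] sg(2)[of x5]
        sg(3)[of x1] sg(3)[of x2] sg(3)[of x3] sg(3)[of x4] sg(3)[of x5] w v by algebra+
    ultimately show "2 * (\<bar>x1\<bar> + \<bar>x3\<bar> + \<bar>x2\<bar> + \<bar>x4\<bar> + \<bar>x5\<bar>) \<le>
        \<bar>2*\<bar>x1\<bar> - ((4*q+3)*wu + (- (sg x1 * sg x2)*wb - sg x1 * sg x4 *wc - - (sg x1 * sg x5)*wd))\<bar> +
        \<bar>2*\<bar>x3\<bar> - ((4*q+3)*wv + (sg x1 * sg x3*(sg x1 * sg x2)*wb +
          sg x1 * sg x3*(sg x1 * sg x4)*wc + sg x1 * sg x3* - (sg x1 * sg x5)*wd))\<bar> +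
        \<bar>2*\<bar>x2\<bar> - ((4*q+2)*wb + (sg x1 * sg x2*wu - sg x1 * sg x3*(sg x1 * sg x2)*wv))\<bar> +
        \<bar>2*\<bar>x4\<bar> - ((4*q+3)*wc + (sg x1 * sg x4*wu -
          sg x1 * sg x3*(sg x1 * sg x4)*wv - sg x1 * sg x4* - (sg x1 * sg x5)*wd))\<bar> +
        \<bar>2*\<bar>x5\<bar> - ((4*q+3)*wd + (- (sg x1 * sg x5)*wu -
          sg x1 * sg x3*- (sg x1 * sg x5)*wv + sg x1 * sg x4* - (sg x1 * sg x5)*wc))\<bar>"
      by (simp only: sg(4))
  qed
  then have "\<bar>x1\<bar> + \<bar>x2\<bar> + \<bar>x3\<bar> + \<bar>x4\<bar> + \<bar>x5\<bar> \<le> 5*q + 3" by (simp only: ac_simps)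
  then show ?thesis using \<open>P x\<close> unfolding P_def x prod.case mult_1_right by blast
qed

section \<open>A residue without shorter representatives\<close>

text \<open>Bound the norm of 2v(w) below by pairing it with the signs of \<open>w\<close>. By
  antisymmetry each off-diagonal pair i, j yields a sign times the difference of \<open>W wi\<close>
  and \<open>W wj\<close>, at least \<open>- (W wi - 1) - (W wj - 1)\<close>. As row i has
  \<open>D_i\<close> such entries, at least \<open>4*q * W wi + D_i\<close> remains from each
  diagonal term.\<close>

lemma odd_lattice_norm_ge:
  fixes q w1 w2 w3 w4 w5 :: int
  assumes "q \<ge> 0" "odd w1" "odd w2" "odd w3" "odd w4" "odd w5"
  shows "20*q + 14 \<le> \<bar>(4*q+3)*w1 - w2 - w4 + w5\<bar> + \<bar>(4*q+2)*w2 + w1 - w3\<bar> + \<bar>(4*q+3)*w3 + w2 + w4 - w5\<bar> +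
    \<bar>(4*q+3)*w4 + w1 - w3 + w5\<bar> + \<bar>(4*q+3)*w5 - w1 + w3 - w4\<bar>"
proof -
  define W where "W = (\<lambda>i. \<bar>i\<bar> :: int)"
  have pos: "W w1 \<ge> 1" "W w2 \<ge> 1" "W w3 \<ge> 1" "W w4 \<ge> 1" "W w5 \<ge> 1"
    using assms by (auto simp: W_def int_one_le_iff_zero_less)
  have sgn: "sgn a * sgn a = 1" "a = sgn a * W a" if "odd a" for a :: int
    using that by (auto simp: W_def sgn_if)
  have le: "sgn a * b \<le> \<bar>b\<bar>" for a b :: int by (auto simp: sgn_if)
  have edge: "- (W a - 1) - (W b - 1) \<le> sgn c * sgn d * (W a - W b)" if "W a \<ge> 1" "W b \<ge> 1" for a b c d :: int
    using that by (auto simp: sgn_if)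
  note edges = edge[OF pos(1) pos(2), of w1 w2] edge[OF pos(1) pos(4), of w1 w4] edge[OF pos(5) pos(1), of w1 w5]
    edge[OF pos(2) pos(3), of w2 w3] edge[OF pos(4) pos(3), of w3 w4] edge[OF pos(3) pos(5), of w3 w5]
    edge[OF pos(5) pos(4), of w4 w5]
  have collect: "e = 4 * (a1 + a2 + a3 + a4 + a5) + 3 * c1 + 2 * c2 + 3 * c3 + 3 * c4 + 3 * c5 +
      e1 + e2 + e3 + e4 + e5 + e6 + e7 \<Longrightarrow>
      q * 1 \<le> a1 \<Longrightarrow> q * 1 \<le> a2 \<Longrightarrow> q * 1 \<le> a3 \<Longrightarrow> q * 1 \<le> a4 \<Longrightarrow> q * 1 \<le> a5 \<Longrightarrow>
      - (c1 - 1) - (c2 - 1) \<le> e1 \<Longrightarrow> - (c1 - 1) - (c4 - 1) \<le> e2 \<Longrightarrow> - (c5 - 1) - (c1 - 1) \<le> e3 \<Longrightarrow>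
      - (c2 - 1) - (c3 - 1) \<le> e4 \<Longrightarrow> - (c4 - 1) - (c3 - 1) \<le> e5 \<Longrightarrow> - (c3 - 1) - (c5 - 1) \<le> e6 \<Longrightarrow>
      - (c5 - 1) - (c4 - 1) \<le> e7 \<Longrightarrow> 20*q + 14 \<le> e"
    for e a1 a2 a3 a4 a5 c1 c2 c3 c4 c5 e1 e2 e3 e4 e5 e6 e7 :: int
    by presburger
  have "sgn w1 * ((4*q+3)*w1 - w2 - w4 + w5) + sgn w2 * ((4*q+2)*w2 + w1 - w3) + sgn w3 * ((4*q+3)*w3 + w2 + w4 - w5) +
      sgn w4 * ((4*q+3)*w4 + w1 - w3 + w5) + sgn w5 * ((4*q+3)*w5 - w1 + w3 - w4) =
    4 * (q * W w1 + q * W w2 + q * W w3 + q * W w4 + q * W w5) + 3 * W w1 + 2 * W w2 + 3 * W w3 + 3 * W w4 + 3 * W w5 +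
    sgn w1 * sgn w2 * (W w1 - W w2) + sgn w1 * sgn w4 * (W w1 - W w4) + sgn w1 * sgn w5 * (W w5 - W w1) +
    sgn w2 * sgn w3 * (W w2 - W w3) + sgn w3 * sgn w4 * (W w4 - W w3) + sgn w3 * sgn w5 * (W w3 - W w5) +
    sgn w4 * sgn w5 * (W w5 - W w4)"
    using sgn[OF assms(2)] sgn[OF assms(3)] sgn[OF assms(4)] sgn[OF assms(5)] sgn[OF assms(6)] by algebra
  moreover have "q * 1 \<le> q * W w1" "q * 1 \<le> q * W w2" "q * 1 \<le> q * W w3" "q * 1 \<le> q * W w4" "q * 1 \<le> q * W w5"
    by (rule mult_left_mono[OF pos(1) assms(1)] mult_left_mono[OF pos(2) assms(1)] mult_left_mono[OF pos(3) assms(1)]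
        mult_left_mono[OF pos(4) assms(1)] mult_left_mono[OF pos(5) assms(1)])+
  ultimately have "20*q + 14 \<le> sgn w1 * ((4*q+3)*w1 - w2 - w4 + w5) + sgn w2 * ((4*q+2)*w2 + w1 - w3) +
      sgn w3 * ((4*q+3)*w3 + w2 + w4 - w5) + sgn w4 * ((4*q+3)*w4 + w1 - w3 + w5) + sgn w5 * ((4*q+3)*w5 - w1 + w3 - w4)"
    using edges by (rule collect)
  also have "\<dots> \<le> \<bar>(4*q+3)*w1 - w2 - w4 + w5\<bar> + \<bar>(4*q+2)*w2 + w1 - w3\<bar> + \<bar>(4*q+3)*w3 + w2 + w4 - w5\<bar> +
    \<bar>(4*q+3)*w4 + w1 - w3 + w5\<bar> + \<bar>(4*q+3)*w5 - w1 + w3 - w4\<bar>"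
    by (intro add_mono le)
  finally show ?thesis .
qed

text \<open>Since \<open>2*a \<le> 4*q\<close>, subtracting a multiple of \<open>4*q\<close> cannot
  bring \<open>a\<close> closer to 0, and the part \<open>D * u\<close> pushes further in the same
  direction.\<close>

lemma abs_diff_multiple_ge:
  fixes a q D u :: int
  assumes "0 \<le> a" "a \<le> 2*q" "D \<ge> 0"
  shows "a + D * \<bar>u\<bar> \<le> \<bar>a - (4*q + D) * u\<bar>"
proof (cases "u \<ge> 1")
  case True
  then have "2*q * 1 \<le> 2*q * u" using assms by (intro mult_left_mono) auto
  then show ?thesis using True assms by (simp add: algebra_simps abs_if)
next
  case False
  then consider "u = 0" | "u < 0" by linarith
  then show ?thesis
  proof cases
    case 1
    then show ?thesis using assms by simp
  next
    case 2
    then have "0 \<le> q * (- u)" using assms by (intro mult_nonneg_nonneg) auto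
    then show ?thesis using 2 assms by (simp add: algebra_simps abs_if)
  qed
qed

lemma five_generators_far_point:
  assumes q: "q \<ge> 1"
    and cong: "[(q+1) + (q+1) * gen2 q + (q+1) * gen3 q + q * gen4 q + q * gen5 q =
      x1*1 + x2 * gen2 q + x3 * gen3 q + x4 * gen4 q + x5 * gen5 q] (mod circ_order q)"
  shows "5*q + 3 \<le> \<bar>x1\<bar> + \<bar>x2\<bar> + \<bar>x3\<bar> + \<bar>x4\<bar> + \<bar>x5\<bar>"
proof -
  obtain m where "(q+1) + (q+1) * gen2 q + (q+1) * gen3 q + q * gen4 q + q * gen5 q -
      (x1*1 + x2 * gen2 q + x3 * gen3 q + x4 * gen4 q + x5 * gen5 q) = circ_order q * m"
    using cong unfolding cong_iff_dvd_diff by (elim dvdE)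
  then have "(q+1 - x1) + (q+1 - x2) * gen2 q + (q+1 - x3) * gen3 q + (q - x4) * gen4 q + (q - x5) * gen5 q =
      circ_order q * m" by algebra
  then obtain w1 w2 w3 w4 w5 where
    par: "even w2 = even w1" "even w3 = even w1" "even w4 = even w1" "even w5 = even w1" and
    w: "2*(q+1 - x1) = (4*q+3)*w1 - w2 - w4 + w5" "2*(q+1 - x2) = (4*q+2)*w2 + w1 - w3"
    "2*(q+1 - x3) = (4*q+3)*w3 + w2 + w4 - w5" "2*(q - x4) = (4*q+3)*w4 + w1 - w3 + w5"
    "2*(q - x5) = (4*q+3)*w5 - w1 + w3 - w4"
    by (rule generators_kernel_lattice)
  show ?thesis
  proof (cases "even w1")
    case True
    with par obtain u1 u2 u3 u4 u5 where u: "w1 = 2*u1" "w2 = 2*u2" "w3 = 2*u3" "w4 = 2*u4" "w5 = 2*u5"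
      by (metis evenE)
    have x: "x1 = (q+1) - (4*q+3)*u1 + u2 + u4 - u5" "x2 = (q+1) - (4*q+2)*u2 - u1 + u3"
      "x3 = (q+1) - (4*q+3)*u3 - u2 - u4 + u5" "x4 = q - (4*q+3)*u4 - u1 + u3 - u5" "x5 = q - (4*q+3)*u5 + u1 - u3 + u4"
      using w unfolding u by algebra+
    have tri: "\<bar>a\<bar> - \<bar>b\<bar> - \<bar>c\<bar> - \<bar>e\<bar> \<le> \<bar>a + b + c - e\<bar>" "\<bar>a\<bar> - \<bar>b\<bar> - \<bar>c\<bar> - \<bar>e\<bar> \<le> \<bar>a - b - c + e\<bar>"
      "\<bar>a\<bar> - \<bar>b\<bar> - \<bar>c\<bar> - \<bar>e\<bar> \<le> \<bar>a - b + c - e\<bar>" "\<bar>a\<bar> - \<bar>b\<bar> - \<bar>c\<bar> - \<bar>e\<bar> \<le> \<bar>a + b - c + e\<bar>"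
      "\<bar>a\<bar> - \<bar>b\<bar> - \<bar>c\<bar> \<le> \<bar>a - b + c\<bar>" for a b c e :: int by linarith+
    \<comment> \<open>The bound \<open>a \<le> 2*q\<close> for \<open>a = q+1\<close> is where
      \<open>q \<ge> 1\<close> enters.\<close>
    have far: "a + 3 * \<bar>v\<bar> \<le> \<bar>a - (4*q+3)*v\<bar>" "a + 2 * \<bar>v\<bar> \<le> \<bar>a - (4*q+2)*v\<bar>" if "a = q \<or> a = q+1" for a v
      using abs_diff_multiple_ge[of a q 3 v] abs_diff_multiple_ge[of a q 2 v] that q by auto
    have "q+1 + 3*\<bar>u1\<bar> - \<bar>u2\<bar> - \<bar>u4\<bar> - \<bar>u5\<bar> \<le> \<bar>x1\<bar>" "q+1 + 2*\<bar>u2\<bar> - \<bar>u1\<bar> - \<bar>u3\<bar> \<le> \<bar>x2\<bar>"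
      "q+1 + 3*\<bar>u3\<bar> - \<bar>u2\<bar> - \<bar>u4\<bar> - \<bar>u5\<bar> \<le> \<bar>x3\<bar>" "q + 3*\<bar>u4\<bar> - \<bar>u1\<bar> - \<bar>u3\<bar> - \<bar>u5\<bar> \<le> \<bar>x4\<bar>"
      "q + 3*\<bar>u5\<bar> - \<bar>u1\<bar> - \<bar>u3\<bar> - \<bar>u4\<bar> \<le> \<bar>x5\<bar>"
      unfolding x
      by (rule order_trans[OF _ tri(1)] order_trans[OF _ tri(2)] order_trans[OF _ tri(3)] order_trans[OF _ tri(4)]
          order_trans[OF _ tri(5)], use far in \<open>simp add: diff_right_mono\<close>)+
    \<comment> \<open>Each \<open>bi\<close> is gained \<open>D_i\<close> times on the diagonal and
      lost once in each of \<open>D_i\<close> other rows, so the sum leaves exactly the norm of the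
      given point.\<close>
    moreover have "q+1 + 3*b1 - b2 - b4 - b5 \<le> a1 \<Longrightarrow> q+1 + 2*b2 - b1 - b3 \<le> a2 \<Longrightarrow> q+1 + 3*b3 - b2 - b4 - b5 \<le> a3 \<Longrightarrow>
      q + 3*b4 - b1 - b3 - b5 \<le> a4 \<Longrightarrow> q + 3*b5 - b1 - b3 - b4 \<le> a5 \<Longrightarrow> 5*q + 3 \<le> a1 + a2 + a3 + a4 + a5"
      for a1 a2 a3 a4 a5 b1 b2 b3 b4 b5 by linarith
    ultimately show ?thesis by blast
  next
    case False
    have dist: "\<bar>2*(a - b)\<bar> \<le> 2*a + 2*\<bar>b\<bar>" if "a = q \<or> a = q+1" for a b using that q by auto
    have sum5: "20*q + 14 \<le> e1 + e2 + e3 + e4 + e5 \<Longrightarrow> e1 \<le> 2*(q+1) + 2*a1 \<Longrightarrow> e2 \<le> 2*(q+1) + 2*a2 \<Longrightarrow>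
        e3 \<le> 2*(q+1) + 2*a3 \<Longrightarrow> e4 \<le> 2*q + 2*a4 \<Longrightarrow> e5 \<le> 2*q + 2*a5 \<Longrightarrow> 5*q + 3 \<le> a1 + a2 + a3 + a4 + a5"
      for a1 a2 a3 a4 a5 e1 e2 e3 e4 e5 by presburger
    \<comment> \<open>The two representatives differ by an odd lattice vector of norm at least
      \<open>10*q + 7\<close>, so the triangle inequality even leaves \<open>5*q + 4\<close> for
      \<open>x\<close>.\<close>
    have "20*q + 14 \<le> \<bar>2*(q+1 - x1)\<bar> + \<bar>2*(q+1 - x2)\<bar> + \<bar>2*(q+1 - x3)\<bar> + \<bar>2*(q - x4)\<bar> + \<bar>2*(q - x5)\<bar>"
      unfolding w using odd_lattice_norm_ge[of q w1 w2 w3 w4 w5] False par q by simp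
    then show ?thesis by (rule sum5) (simp_all only: dist simp_thms)
  qed
qed

section \<open>The graph for \<open>q = 0\<close>\<close>

lemma diameter_156: "graph_diameter (with_proj (circulant 156 {1, 27, 103, 120, 150})) = ereal 3"
proof -
  let ?S = "{1, 27, 103, 120, 150} :: int set"
  \<comment> \<open>The entry 0 pads shorter words, so that sums of exactly three entries cover all
    words of length at most 3.\<close>
  let ?T = "[0, 1, 27, 103, 120, 150, -1, -27, -103, -120, -150] :: int list"
  have T: "set ?T - {0} \<subseteq> ?S \<union> uminus ` ?S" "?S \<union> uminus ` ?S \<subseteq> set ?T" by auto
  have "graph_diameter (with_proj (circulant 156 ?S)) = ereal (real 3)"
  \<comment> \<open>\<open>131 = 1 + 27 + 103\<close> is the residue of
    \<open>(q+1,q+1,q+1,q,q)\<close> at \<open>q = 0\<close>.\<close>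
  proof (rule graph_diameter_circulant_eqI[where d = 131])
    have sums: "list_all (\<lambda>r. list_ex (\<lambda>a. list_ex (\<lambda>b. list_ex (\<lambda>c. (a + b + c) mod 156 = r) ?T) ?T) ?T) [0..155]"
      by code_simp
    fix d :: int
    have "d mod 156 \<in> set [0..155]" by simp
    with sums obtain a b c where abc: "a \<in> set ?T" "b \<in> set ?T" "c \<in> set ?T" "(a + b + c) mod 156 = d mod 156"
      unfolding list_all_iff list_ex_iff by metis
    have sum_filter: "sum_list (filter (\<lambda>x. x \<noteq> 0) xs) = sum_list xs" for xs :: "int list"
      by (induction xs) auto
    show "\<exists>xs. length xs \<le> 3 \<and> set xs \<subseteq> ?S \<union> uminus ` ?S \<and> [d = sum_list xs] (mod int 156)"
    proof (intro exI[of _ "filter (\<lambda>x. x \<noteq> 0) [a, b, c]"] conjI)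
      show "length (filter (\<lambda>x. x \<noteq> 0) [a, b, c]) \<le> 3"
        by (rule order_trans[OF length_filter_le]) simp
      show "set (filter (\<lambda>x. x \<noteq> 0) [a, b, c]) \<subseteq> ?S \<union> uminus ` ?S"
        using abc(1-3) T(1) by (intro order_trans[OF _ T(1)]) auto
      show "[d = sum_list (filter (\<lambda>x. x \<noteq> 0) [a, b, c])] (mod int 156)"
        using abc(4) unfolding sum_filter by (simp add: cong_def add.assoc)
    qed
  next
    have sums: "list_all (\<lambda>a. list_all (\<lambda>b. (a + b) mod 156 \<noteq> 131) ?T) ?T"
      by code_simp
    have sums: "(a + b) mod 156 \<noteq> 131" if "a \<in> set ?T" "b \<in> set ?T" for a b
      using sums that unfolding list_all_iff by blast
    fix xs assume xs: "set xs \<subseteq> ?S \<union> uminus ` ?S" "[131 = sum_list xs] (mod int 156)"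
    show "3 \<le> length xs"
    proof (rule ccontr)
      assume "\<not> 3 \<le> length xs"
      then consider "xs = []" | a where "xs = [a]" | a b where "xs = [a, b]"
        by (cases xs rule: remdups_adj.cases) (auto simp: Suc_le_eq)
      then obtain a b where "a \<in> set ?T" "b \<in> set ?T" "sum_list xs = a + b"
      proof cases
        case 1
        then show ?thesis using that[of 0 0] by simp
      next
        case (2 a)
        then have "a \<in> set ?T" using xs(1) T(2) by auto
        then show ?thesis using that[of a 0] 2 by simp
      next
        case (3 a b)
        then have "a \<in> set ?T" "b \<in> set ?T" using xs(1) T(2) by auto
        then show ?thesis using that[of a b] 3 by simp
      qed
      then show False using sums[of a b] xs(2) by (simp add: cong_def)
    qed
  qed simp
  then show ?thesis by simp
qed

section \<open>From the lattice back to the graph\<close>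

text \<open>This makes the generators five distinct residues that are already reduced modulo the
  order.\<close>

lemma five_generators_order:
  assumes "q \<ge> 0"
  shows "1 < gen2 q" "gen2 q < gen3 q" "gen3 q < gen4 q" "gen4 q < gen5 q" "gen5 q < circ_order q"
proof -
  have "q^2 \<ge> 0" "q^3 \<ge> 0" "q^4 \<ge> 0" "q^5 \<ge> 0" using assms by simp_all
  then show "1 < gen2 q" "gen2 q < gen3 q" "gen3 q < gen4 q" "gen4 q < gen5 q" "gen5 q < circ_order q"
    using assms unfolding circ_defs by linarith+
qed

theorem theorem8:
  fixes k n :: nat
  assumes "k > 0" and "[k = 3] (mod 5)" and "n = L_CC_10 k"
  shows "(\<exists>S. S \<subseteq> {0..<int n} \<and> card S = 5 \<and>
            graph_diameter (with_proj (circulant n S)) = ereal (real k)) \<and>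
         (let S = (\<lambda>g. g mod int n) ` gens_10 (int k) in
            card S = 5 \<and>
            graph_diameter (with_proj (circulant n S)) = ereal (real k))"
proof -
  define q where "q = int (k div 5)"
  have q0: "q \<ge> 0" by (simp add: q_def)
  have "k = 5 * (k div 5) + 3" using assms(2) unfolding cong_def by presburger
  then have k: "int k = 5*q + 3" unfolding q_def by linarith
  have n: "int n = circ_order q"
  proof -
    have "int n = (512 * int k^5 + 1280 * int k^4 + 6560 * int k^3 + 7600 * int k^2 + 4180 * int k + 1344) div 3125"
      unfolding assms(3) L_CC_10_def by (simp add: zdiv_int)
    also have "512 * int k^5 + 1280 * int k^4 + 6560 * int k^3 + 7600 * int k^2 + 4180 * int k + 1344 = 3125 * circ_order q"
      unfolding k circ_order_def by algebra
    finally show ?thesis by simp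
  qed
  have gens: "gens_10 (int k) = {1, gen2 q, gen3 q, gen4 q, gen5 q}"
  proof -
    have "128*(int k)^4 + 64*(int k)^3 + 1112*(int k)^2 - 1224*int k - 1557 = 625 * gen2 q"
      "256*(int k)^4 + 448*(int k)^3 + 2944*(int k)^2 + 1592*int k + 271 = 625 * gen3 q"
      "256*(int k)^4 + 608*(int k)^3 + 3104*(int k)^2 + 3062*int k + 726 = 625 * gen4 q"
      "384*(int k)^4 + 672*(int k)^3 + 4216*(int k)^2 + 2338*int k - 456 = 625 * gen5 q"
      unfolding k gen2_def gen3_def gen4_def gen5_def by algebra+
    then show ?thesis unfolding gens_10_def by (simp only: nonzero_mult_div_cancel_left zero_neq_numeral not_False_eq_True)
  qed
  note ord = five_generators_order[OF q0]
  let ?S = "{1, gen2 q, gen3 q, gen4 q, gen5 q}"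
  have range: "?S \<subseteq> {0..<int n}" using ord unfolding n by auto
  have card: "card ?S = 5" using ord by simp
  \<comment> \<open>Reduction modulo \<open>n\<close> changes nothing, so one set serves both
    conjuncts.\<close>
  have image: "(\<lambda>g. g mod int n) ` ?S = ?S"
    using range by (intro image_cong[where g = id, simplified] mod_pos_pos_trivial) auto
  have diameter: "graph_diameter (with_proj (circulant n ?S)) = ereal (real k)"
  proof (cases "q = 0")
    case True
    then have "n = 156" "k = 3" using n k by (simp_all add: circ_order_def)
    then show ?thesis using True diameter_156 by (simp add: gen2_def gen3_def gen4_def gen5_def)
  next
    case False
    then have q: "q \<ge> 1" using q0 by simp
    show ?thesis
    proof (rule graph_diameter_circulant_five_generators)
      show "n > 0" using ord n by linarith
    qed (use five_generators_covering[OF q] five_generators_far_point[OF q] n k in \<open>simp_all only:\<close>)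
  qed
  show ?thesis
    unfolding Let_def gens image using range card diameter by blast
qed

end
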